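(* Let $n\ge2$, $k\in\{1,\dots,n-1\}$, and let \[P=\begin{bmatrix} N & R\\ 0 & A\end{bmatrix}\in\{0,1\}^{n\times n}\] be nonsingular, with $N\in\{0,1\}^{k\times k}$, $R\in\{0,1\}^{k\times(n-k)}$, $A\in\{0,1\}^{(n-k)\times(n-k)}$, $A$ fully indecomposable, and such that the simplex $\mathrm{conv}\{0,\text{columns of }P\}\subset\mathbb{R}^n$ is nonobtuse. Then: (i) $\mathrm{conv}\{0,\text{columns of }N\}\subset\mathbb{R}^k$ is a nonobtuse simplex; (ii) $\mathrm{conv}\{0,\text{columns of }A\}\subset\mathbb{R}^{n-k}$ is a nonobtuse simplex; (iii) $R=\nu (e^{n-k})^\top$, where $e^{n-k}$ is the all-ones vector of length $n-k$ and $\nu\in\{0,1\}^k$ is either the zero vector or a column of $N$.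
   Context: The dihedral angle between two facets of a simplex is $\pi$ minus the angle between their inward normals; a simplex is nonobtuse if none of its dihedral angles exceeds $\pi/2$. A matrix $A\in\{0,1\}^{m\times m}$ is partly decomposable if there exist $j\in\{1,\dots,m-1\}$ and permutation matrices $\Pi_1,\Pi_2$ with $\Pi_1^\top A\Pi_2=\begin{bmatrix}A_{11}&A_{12}\\0&A_{22}\end{bmatrix}$, $A_{11}$ of size $j\times j$; otherwise $A$ is fully indecomposable. *)

theory Defs
  imports "HOL-Analysis.Analysis"
begin

definition zero_one_matrix :: "real^'n^'m \<Rightarrow> bool" where
  "zero_one_matrix A \<longleftrightarrow> (\<forall>i j. A $ i $ j \<in> {0, 1})"

(* The index types 'k and 'm play the roles of {1..k} and {k+1..n}; their disjoint sum
   'k + 'm indexes the rows and columns of the whole matrix, so n = CARD('k) + CARD('m). *)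
definition block_matrix ::
  "real^'k^'k \<Rightarrow> real^'m^'k \<Rightarrow> real^'k^'m \<Rightarrow> real^'m^'m \<Rightarrow> real^('k + 'm)^('k + 'm)" where
  "block_matrix B11 B12 B21 B22 =
     (\<chi> r c. case (r, c) of
        (Inl i, Inl j) \<Rightarrow> B11 $ i $ j
      | (Inl i, Inr j) \<Rightarrow> B12 $ i $ j
      | (Inr i, Inl j) \<Rightarrow> B21 $ i $ j
      | (Inr i, Inr j) \<Rightarrow> B22 $ i $ j)"

definition permutation_matrix :: "real^'m^'m \<Rightarrow> bool" where
  "permutation_matrix Q \<longleftrightarrow>
     (\<exists>p. p permutes UNIV \<and> Q = (\<chi> i j. if i = p j then 1 else 0))"

(* A finite index type carries no order, so rows and columns are numbered 0, ..., m-1 by the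
   fixed enumeration to_nat_on UNIV. The lower left (m-j) x j block consists of the entries
   whose row number is at least j and whose column number is less than j. As the permutation
   matrices are arbitrary, the choice of enumeration is immaterial. *)
definition lower_left_block_zero :: "nat \<Rightarrow> real^'m^'m \<Rightarrow> bool" where
  "lower_left_block_zero j B \<longleftrightarrow>
     (\<forall>r c. j \<le> to_nat_on UNIV r \<and> to_nat_on UNIV c < j \<longrightarrow> B $ r $ c = 0)"

definition partly_decomposable :: "real^'m^'m \<Rightarrow> bool" where
  "partly_decomposable A \<longleftrightarrow>
     (\<exists>j \<in> {1..CARD('m) - 1}. \<exists>Q1 Q2. permutation_matrix Q1 \<and> permutation_matrix Q2 \<and>
        lower_left_block_zero j (transpose Q1 ** A ** Q2))"

definition fully_indecomposable :: "real^'m^'m \<Rightarrow> bool" where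
  "fully_indecomposable A \<longleftrightarrow> \<not> partly_decomposable A"

definition vector_angle :: "'a::real_inner \<Rightarrow> 'a \<Rightarrow> real" where
  "vector_angle u v = arccos (u \<bullet> v / (norm u * norm v))"

(* The unit inward normal exists and is unique when S is a full-dimensional polytope and
   F is one of its facets; inward_normal is only used in that situation. *)
definition inward_normal :: "'a::euclidean_space set \<Rightarrow> 'a set \<Rightarrow> 'a" where
  "inward_normal S F =
     (THE v. norm v = 1 \<and> (\<forall>x\<in>F. \<forall>y\<in>F. v \<bullet> (y - x) = 0) \<and>
        (\<forall>x\<in>F. \<forall>y\<in>S. 0 \<le> v \<bullet> (y - x)))"

definition dihedral_angle ::
  "'a::euclidean_space set \<Rightarrow> 'a set \<Rightarrow> 'a set \<Rightarrow> real" where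
  "dihedral_angle S F G = pi - vector_angle (inward_normal S F) (inward_normal S G)"

definition nonobtuse_simplex :: "'a::euclidean_space set \<Rightarrow> bool" where
  "nonobtuse_simplex S \<longleftrightarrow>
     int DIM('a) simplex S \<and>
     (\<forall>F G. F facet_of S \<and> G facet_of S \<and> F \<noteq> G \<longrightarrow> dihedral_angle S F G \<le> pi / 2)"

definition column_simplex :: "real^'n^'n \<Rightarrow> (real^'n) set" where
  "column_simplex A = convex hull (insert 0 (columns A))"

end

theory Submission
  imports Defs
begin

text \<open>
  With \<open>q\<^sub>i\<close> the rows of the inverse of \<open>B\<close>, the simplex of \<open>B\<close> is nonobtuse iff
  \<open>q\<^sub>i \<bullet> q\<^sub>j \<le> 0\<close> for \<open>i \<noteq> j\<close> and \<open>0 \<le> q\<^sub>i \<bullet> (\<Sum>j. q\<^sub>j)\<close>. The inverse of \<open>P\<close> has the rows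
  \<open>(x\<^sub>i, - b\<^sub>i)\<close> and \<open>(0, z\<^sub>j)\<close>, where \<open>x\<^sub>i\<close> and \<open>z\<^sub>j\<close> are the rows of the inverses of \<open>N\<close> and \<open>A\<close>.
  Nonobtuseness of \<open>P\<close> says that the \<open>b\<^sub>i\<close> and \<open>s = (\<Sum>j. z\<^sub>j) - (\<Sum>i. b\<^sub>i)\<close> have nonnegative inner
  products with all \<open>z\<^sub>j\<close>, hence lie in the cone spanned by the columns of \<open>A\<close>. As these columns are
  nonnegative, inner products within the cone are nonnegative, which gives (i) and (ii) and shows
  that \<open>M = N\<^sup>-\<^sup>1 R\<close>, with entries the inner products of \<open>b\<^sub>i\<close> with the columns of \<open>A\<close>, is
  nonnegative with column sums at most 1. Since \<open>R = N M\<close> is a 0/1-matrix, so is \<open>M\<close>. If a row of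
  \<open>M\<close> is the indicator of a set \<open>U\<close>, then \<open>b\<^sub>i = (\<Sum>j\<in>U. z\<^sub>j)\<close>, and the sign conditions force
  \<open>z\<^sub>l \<bullet> z\<^sub>j = 0\<close> for \<open>l \<in> U\<close>, \<open>j \<notin> U\<close>. Then the columns of \<open>A\<close> in \<open>U\<close> are orthogonal to the
  others, so \<open>U\<close> is empty or everything because \<open>A\<close> is fully indecomposable. At most one row of
  \<open>M\<close> is nonzero, which is (iii).
\<close>

section \<open>Facets, inward normals and dihedral angles of a simplex\<close>

text \<open>Here \<open>q i\<close> is an unnormalized inward normal of the facet opposite the
  vertex \<open>v i\<close>. The assumption \<open>full_dim\<close> says that the vertices affinely
  span the space, which makes the unit normal unique.\<close>

locale simplex_normals =
  fixes v q :: "'i::finite \<Rightarrow> 'a::euclidean_space"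
  assumes normal_const: "j \<noteq> i \<Longrightarrow> l \<noteq> i \<Longrightarrow> q i \<bullet> v j = q i \<bullet> v l"
    and normal_less: "j \<noteq> i \<Longrightarrow> q i \<bullet> v j < q i \<bullet> v i"
    and full_dim: "(\<And>j l. w \<bullet> v j = w \<bullet> v l) \<Longrightarrow> w = 0"
    and two_le_card: "2 \<le> CARD('i)"
begin

lemma ex_other: "\<exists>j. j \<noteq> (i::'i)"
proof (rule ccontr)
  assume "\<not> ?thesis"
  then have "(UNIV::'i set) = {i}" by auto
  then have "CARD('i) = 1" by (metis card.empty card.insert finite.emptyI empty_iff One_nat_def)
  then show False using two_le_card by simp
qed

lemma inj_v: "inj v"
  using normal_less by (metis injI less_irrefl)

lemma normal_nonzero: "q i \<noteq> 0"
  using ex_other[of i] normal_less by (metis inner_zero_left less_irrefl)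

lemma normal_facet_hull:
  assumes "j \<noteq> i" "x \<in> convex hull (v ` (- {i}))"
  shows "q i \<bullet> x = q i \<bullet> v j"
proof -
  have "convex hull (v ` (- {i})) \<subseteq> {x. q i \<bullet> x = q i \<bullet> v j}"
    by (intro hull_minimal convex_hyperplane) (use normal_const[OF _ assms(1)] in blast)
  then show ?thesis using assms by auto
qed

lemma normal_hull_ge:
  assumes "j \<noteq> i" "x \<in> convex hull (range v)"
  shows "q i \<bullet> v j \<le> q i \<bullet> x"
proof -
  have "q i \<bullet> v j \<le> q i \<bullet> v l" for l
    using assms(1) normal_const[of j i l] normal_less[of j i] by (cases "l = i") auto
  then have "convex hull (range v) \<subseteq> {x. q i \<bullet> x \<ge> q i \<bullet> v j}"
    by (intro hull_minimal convex_halfspace_ge) auto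
  then show ?thesis using assms by auto
qed

lemma inward_normal_eq:
  "inward_normal (convex hull (range v)) (convex hull (v ` (- {i}))) = q i /\<^sub>R norm (q i)"
  (is "inward_normal ?S ?F = ?n")
  unfolding inward_normal_def
proof (rule the_equality)
  obtain j where j: "j \<noteq> i" using ex_other by blast
  have "?n \<bullet> (y - x) = 0" if "x \<in> ?F" "y \<in> ?F" for x y
    using normal_facet_hull[OF j] that by (simp add: inner_diff_right)
  moreover have "0 \<le> ?n \<bullet> (y - x)" if "x \<in> ?F" "y \<in> ?S" for x y
    using normal_facet_hull[OF j that(1)] normal_hull_ge[OF j that(2)]
    by (simp add: inner_diff_right mult_left_mono)
  ultimately show "norm ?n = 1 \<and> (\<forall>x\<in>?F. \<forall>y\<in>?F. ?n \<bullet> (y - x) = 0) \<and>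
        (\<forall>x\<in>?F. \<forall>y\<in>?S. 0 \<le> ?n \<bullet> (y - x))"
    using normal_nonzero by simp
  fix w
  assume "norm w = 1 \<and> (\<forall>x\<in>?F. \<forall>y\<in>?F. w \<bullet> (y - x) = 0) \<and>
        (\<forall>x\<in>?F. \<forall>y\<in>?S. 0 \<le> w \<bullet> (y - x))"
  then have "norm w = 1" and w0: "\<And>x y. x \<in> ?F \<Longrightarrow> y \<in> ?F \<Longrightarrow> w \<bullet> (y - x) = 0"
    and w_ge: "\<And>x y. x \<in> ?F \<Longrightarrow> y \<in> ?S \<Longrightarrow> 0 \<le> w \<bullet> (y - x)"
    by blast+
  have inF: "v l \<in> ?F" if "l \<noteq> i" for l using that by (auto intro: hull_inc)
  have inS: "v l \<in> ?S" for l by (auto intro: hull_inc)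
  have wF: "w \<bullet> v l = w \<bullet> v j" if "l \<noteq> i" for l
    using w0[OF inF[OF j] inF[OF that]] by (simp add: inner_diff_right)
  \<comment> \<open>These are the rises of \<open>w\<close> and \<open>q i\<close> from the facet to
    the opposite vertex. Weighting each vector by the other's rise makes the difference constant on
    all vertices, hence zero by \<open>full_dim\<close>. So \<open>w\<close> is a multiple of
    \<open>q i\<close>, and \<open>norm w = 1\<close> with \<alpha> \<ge> 0 fixes the
    factor.\<close>
  define \<alpha> where "\<alpha> = w \<bullet> v i - w \<bullet> v j"
  define \<beta> where "\<beta> = q i \<bullet> v i - q i \<bullet> v j"
  have "\<alpha> \<ge> 0" using w_ge[OF inF[OF j] inS[of i]] by (simp add: \<alpha>_def inner_diff_right)
  have "\<beta> > 0" using normal_less[OF j] by (simp add: \<beta>_def)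
  have to_j: "(\<beta> *\<^sub>R w - \<alpha> *\<^sub>R q i) \<bullet> v l = (\<beta> *\<^sub>R w - \<alpha> *\<^sub>R q i) \<bullet> v j" for l
  proof (cases "l = i")
    case True
    then show ?thesis by (simp add: \<alpha>_def \<beta>_def inner_diff_left algebra_simps)
  next
    case False
    then show ?thesis using wF[OF False] normal_const[OF False j]
      by (simp add: inner_diff_left)
  qed
  have "\<beta> *\<^sub>R w - \<alpha> *\<^sub>R q i = 0"
    by (rule full_dim) (metis to_j)
  then have eq: "\<beta> *\<^sub>R w = \<alpha> *\<^sub>R q i" by simp
  then have "norm (\<beta> *\<^sub>R w) = norm (\<alpha> *\<^sub>R q i)" by simp
  then have \<beta>: "\<beta> = \<alpha> * norm (q i)" using \<open>norm w = 1\<close> \<open>\<alpha> \<ge> 0\<close> \<open>\<beta> > 0\<close> by simp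
  then have "\<alpha> \<noteq> 0" using \<open>\<beta> > 0\<close> by auto
  have "\<alpha> *\<^sub>R (norm (q i) *\<^sub>R w) = \<alpha> *\<^sub>R q i" using eq \<beta> by simp
  then have "norm (q i) *\<^sub>R w = q i" using \<open>\<alpha> \<noteq> 0\<close> by (metis scaleR_cancel_left)
  then have "?n = (norm (q i) *\<^sub>R w) /\<^sub>R norm (q i)" by simp
  then show "w = ?n" using normal_nonzero[of i] by simp
qed

lemma affine_independent_v: "\<not> affine_dependent (range v)"
proof
  assume "affine_dependent (range v)"
  then obtain i where i: "v i \<in> affine hull (range v - {v i})"
    by (auto simp: affine_dependent_def)
  obtain j where j: "j \<noteq> i" using ex_other by blast
  have "q i \<bullet> v l = q i \<bullet> v j" if "v l \<noteq> v i" for l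
    using normal_const[OF _ j, of l] that by blast
  then have "affine hull (range v - {v i}) \<subseteq> {x. q i \<bullet> x = q i \<bullet> v j}"
    by (intro hull_minimal affine_hyperplane) blast
  then show False using i normal_less[OF j] by auto
qed

lemma facet_iff:
  "F facet_of (convex hull (range v)) \<longleftrightarrow> (\<exists>i. F = convex hull (v ` (- {i})))"
proof -
  have "range v - {v i} = v ` (- {i})" for i
    using inj_v by (auto simp: inj_def)
  moreover have "card (range v) \<ge> 2"
    using two_le_card inj_v by (simp add: card_image)
  ultimately show ?thesis
    using facet_of_convex_hull_affine_independent_alt[OF affine_independent_v] by auto
qed

lemma facet_inj:
  assumes "i \<noteq> j"
  shows "convex hull (v ` (- {i})) \<noteq> convex hull (v ` (- {j}))"
proof -
  have "v j \<in> convex hull (v ` (- {i}))" using assms by (auto intro: hull_inc)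
  moreover have "v j \<notin> convex hull (v ` (- {j}))"
    using normal_facet_hull[of i j "v j"] normal_less[of i j] assms by auto
  ultimately show ?thesis by auto
qed

lemma dihedral_angle_le_iff:
  "dihedral_angle (convex hull (range v)) (convex hull (v ` (- {i}))) (convex hull (v ` (- {j}))) \<le> pi / 2
    \<longleftrightarrow> q i \<bullet> q j \<le> 0"
proof -
  let ?a = "q i /\<^sub>R norm (q i)" and ?b = "q j /\<^sub>R norm (q j)"
  have n: "norm ?a = 1" "norm ?b = 1" using normal_nonzero by auto
  \<comment> \<open>This keeps the argument in the interval where \<open>arccos\<close> is strictly
    decreasing, and \<open>arccos 0\<close> is pi/2.\<close>
  have "\<bar>?a \<bullet> ?b\<bar> \<le> 1" using Cauchy_Schwarz_ineq2[of ?a ?b] n by simp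
  then have "arccos 0 \<le> arccos (?a \<bullet> ?b) \<longleftrightarrow> ?a \<bullet> ?b \<le> 0"
    by (subst arccos_le_mono) auto
  moreover have "?a \<bullet> ?b \<le> 0 \<longleftrightarrow> q i \<bullet> q j \<le> 0"
    using normal_nonzero[of i] normal_nonzero[of j] by (simp add: mult_le_0_iff)
  ultimately show ?thesis
    unfolding dihedral_angle_def inward_normal_eq vector_angle_def n by auto
qed

lemma nonobtuse_simplex_iff:
  assumes "CARD('i) = DIM('a) + 1"
  shows "nonobtuse_simplex (convex hull (range v)) \<longleftrightarrow> (\<forall>i j. i \<noteq> j \<longrightarrow> q i \<bullet> q j \<le> 0)"
proof -
  have "int DIM('a) simplex (convex hull (range v))"
    unfolding simplex_def using affine_independent_v assms inj_v by (auto simp: card_image intro!: exI[of _ "range v"])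
  then show ?thesis
    unfolding nonobtuse_simplex_def facet_iff
    using facet_inj dihedral_angle_le_iff by metis
qed

end

section \<open>Dual bases and nonobtuseness in terms of the inverse matrix\<close>

lemma left_inverse_row_inner_column:
  fixes X B :: "real^'n^'n"
  assumes "X ** B = mat 1"
  shows "X $ i \<bullet> column j B = (if i = j then 1 else 0)"
proof -
  have "(X ** B) $ i $ j = X $ i \<bullet> column j B"
    by (simp add: matrix_matrix_mult_def inner_vec_def column_def)
  then show ?thesis using assms by (simp add: mat_def)
qed

text \<open>The rows of \<open>X\<close> and the columns of \<open>B\<close> are dual bases; the two
  sums are \<open>x\<close> multiplied by \<open>B ** X\<close> from either side.\<close>

lemma dual_basis_expansions:
  fixes X B :: "real^'n^'n"
  assumes XB: "X ** B = mat 1"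
  shows "(\<Sum>j\<in>UNIV. (x \<bullet> X $ j) *\<^sub>R column j B) = x"
    and "(\<Sum>j\<in>UNIV. (x \<bullet> column j B) *\<^sub>R X $ j) = x"
proof -
  have BX: "B ** X = mat 1" using XB matrix_left_right_inverse by blast
  have "(\<Sum>j\<in>UNIV. (x \<bullet> X $ j) *\<^sub>R column j B) = B *v (X *v x)"
    by (simp add: vec_eq_iff matrix_vector_mult_def inner_vec_def column_def mult.commute)
  also have "\<dots> = x" by (simp add: matrix_vector_mul_assoc BX)
  finally show "(\<Sum>j\<in>UNIV. (x \<bullet> X $ j) *\<^sub>R column j B) = x" .
  have "(\<Sum>j\<in>UNIV. (x \<bullet> column j B) *\<^sub>R X $ j) = (x v* B) v* X"
    by (simp add: vec_eq_iff vector_matrix_mult_def inner_vec_def column_def mult.commute)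
  also have "\<dots> = x" by (simp add: vector_matrix_mul_assoc BX)
  finally show "(\<Sum>j\<in>UNIV. (x \<bullet> column j B) *\<^sub>R X $ j) = x" .
qed

text \<open>The inward normal of the facet opposite column \<open>i\<close> is row \<open>i\<close> of the inverse; that of the
  facet opposite the origin is minus the sum of all rows.\<close>

lemma nonobtuse_column_simplex_iff:
  fixes X B :: "real^'n^'n"
  assumes XB: "X ** B = mat 1"
  shows "nonobtuse_simplex (column_simplex B) \<longleftrightarrow>
    (\<forall>i j. i \<noteq> j \<longrightarrow> X $ i \<bullet> X $ j \<le> 0) \<and> (\<forall>i. 0 \<le> X $ i \<bullet> (\<Sum>j\<in>UNIV. X $ j))"
proof -
  define v :: "'n option \<Rightarrow> real^'n" where "v = case_option 0 (\<lambda>j. column j B)"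
  define q :: "'n option \<Rightarrow> real^'n" where "q = case_option (- (\<Sum>j\<in>UNIV. X $ j)) (\<lambda>j. X $ j)"
  note dual = left_inverse_row_inner_column[OF XB]
  have v: "v None = 0" "\<And>j. v (Some j) = column j B" by (auto simp: v_def)
  have q: "q None = - (\<Sum>j\<in>UNIV. X $ j)" "\<And>j. q (Some j) = X $ j" by (auto simp: q_def)
  \<comment> \<open>\<open>None\<close> indexes the origin. The normal \<open>q None\<close> is thus
    -1 on every column and 0 at the origin, as the locale requires.\<close>
  have sum1: "(\<Sum>j\<in>UNIV. X $ j) \<bullet> column i B = 1" for i
    by (simp add: inner_sum_left dual)
  interpret simplex_normals v q
  proof
    show "q i \<bullet> v j = q i \<bullet> v l" if "j \<noteq> i" "l \<noteq> i" for i j l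
      using that by (cases i; cases j; cases l) (auto simp: v q sum1 dual)
    show "q i \<bullet> v j < q i \<bullet> v i" if "j \<noteq> i" for i j
      using that by (cases i; cases j) (auto simp: v q sum1 dual)
    show "w = 0" if "\<And>j l. w \<bullet> v j = w \<bullet> v l" for w
    proof -
      have "w \<bullet> column j B = 0" for j using that[of "Some j" None] by (simp add: v)
      then show ?thesis using dual_basis_expansions(2)[OF XB, of w] by simp
    qed
    show "2 \<le> CARD('n option)" by (simp add: card_UNIV_option Suc_le_eq)
  qed
  have "column_simplex B = convex hull (range v)"
    unfolding column_simplex_def columns_def by (simp add: UNIV_option_conv v image_image full_SetCompr_eq)
  moreover have "(\<forall>i j. i \<noteq> j \<longrightarrow> q i \<bullet> q j \<le> 0) \<longleftrightarrow>
    (\<forall>i j. i \<noteq> j \<longrightarrow> X $ i \<bullet> X $ j \<le> 0) \<and> (\<forall>i. 0 \<le> X $ i \<bullet> (\<Sum>j\<in>UNIV. X $ j))"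
    (is "?L \<longleftrightarrow> ?R1 \<and> ?R2")
  proof (intro iffI conjI allI impI)
    fix i j assume ?L
    show "X $ i \<bullet> X $ j \<le> 0" if "i \<noteq> j"
      using \<open>?L\<close>[rule_format, of "Some i" "Some j"] that by (simp add: q)
    show "0 \<le> X $ i \<bullet> (\<Sum>j\<in>UNIV. X $ j)"
      using \<open>?L\<close>[rule_format, of "Some i" None] by (simp add: q)
  next
    fix i j :: "'n option" assume R: "?R1 \<and> ?R2" and "i \<noteq> j"
    then show "q i \<bullet> q j \<le> 0"
      by (cases i; cases j) (auto simp: q inner_commute[of "sum _ _"])
  qed
  ultimately show ?thesis using nonobtuse_simplex_iff by (simp add: card_UNIV_option)
qed

section \<open>Zero blocks and partial decomposability\<close>

lemma permutation_matrix_conj_nth: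
  fixes A :: "real^'m^'m"
  shows "(transpose (\<chi> i j. if i = p j then 1 else 0) ** A ** (\<chi> i j. if i = q j then 1 else 0)) $ r $ c
    = A $ p r $ q c"
proof -
  have *: "(if b then 1 else 0) * x = (if b then x else 0)" "x * (if b then 1 else 0) = (if b then x else 0)"
    for b and x :: real by simp_all
  show ?thesis
    by (simp add: matrix_matrix_mult_def transpose_def *)
qed

lemma permutes_image_eq:
  fixes S T :: "'a::finite set"
  assumes "card S = card T"
  obtains p where "p permutes UNIV" "p ` S = T"
proof -
  have "card (- S) = card (- T)" using assms by (simp add: Compl_eq_Diff_UNIV card_Diff_subset)
  then obtain f g where f: "bij_betw f S T" and g: "bij_betw g (- S) (- T)"
    using assms finite_same_card_bij by (metis finite)
  let ?p = "\<lambda>x. if x \<in> S then f x else g x"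
  have "bij_betw ?p S T" using f by (subst bij_betw_cong[of S ?p f]) auto
  moreover have "bij_betw ?p (- S) (- T)" using g by (subst bij_betw_cong[of "- S" ?p g]) auto
  ultimately have "bij_betw ?p (S \<union> - S) (T \<union> - T)" by (intro bij_betw_combine) auto
  then have "?p permutes UNIV" by (intro bij_imp_permutes) auto
  with \<open>bij_betw ?p S T\<close> show ?thesis by (intro that[of ?p]) (auto simp: bij_betw_def)
qed

text \<open>Shrink \<open>V\<close> to exactly \<open>CARD('m) - card U\<close> rows; one
  permutation then brings these rows to the bottom, another brings the columns in \<open>U\<close>
  to the front.\<close>

lemma partly_decomposableI:
  fixes A :: "real^'m^'m"
  assumes "U \<noteq> {}" "U \<noteq> UNIV" and card: "CARD('m) \<le> card V + card U"
    and zero: "\<And>r c. r \<in> V \<Longrightarrow> c \<in> U \<Longrightarrow> A $ r $ c = 0"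
  shows "partly_decomposable A"
proof -
  let ?num = "to_nat_on (UNIV :: 'm set)" and ?j = "card U"
  have bij: "bij_betw ?num UNIV {..<CARD('m)}" by (simp add: to_nat_on_finite)
  have "?j < CARD('m)" using assms(2) by (metis finite psubset_card_mono psubsetI subset_UNIV)
  moreover have "?j \<ge> 1" using assms(1) by (simp add: Suc_le_eq card_gt_0_iff)
  ultimately have j: "?j \<in> {1..CARD('m) - 1}" by simp
  have cardlow: "card {c. ?num c < ?j} = ?j"
  proof -
    have "?num ` {c. ?num c < ?j} = {..<?j}"
    proof (intro set_eqI iffI)
      fix y assume y: "y \<in> {..<?j}"
      then have "y \<in> ?num ` UNIV" using bij \<open>?j < CARD('m)\<close> by (auto simp: bij_betw_def)
      then show "y \<in> ?num ` {c. ?num c < ?j}" using y by auto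
    qed auto
    moreover have "inj_on ?num {c. ?num c < ?j}" using bij by (auto simp: bij_betw_def inj_on_def)
    ultimately show ?thesis by (metis card_image card_lessThan)
  qed
  obtain V' where V': "V' \<subseteq> V" "card V' = CARD('m) - ?j"
    using card by (meson obtain_subset_with_card_n le_diff_conv)
  have "card {r. ?j \<le> ?num r} = CARD('m) - ?j"
  proof -
    have "{r. ?j \<le> ?num r} = - {c. ?num c < ?j}" by auto
    then show ?thesis by (simp add: Compl_eq_Diff_UNIV card_Diff_subset cardlow)
  qed
  then obtain p where p: "p permutes UNIV" "p ` {r. ?j \<le> ?num r} = V'"
    using permutes_image_eq V'(2) by metis
  obtain q where q: "q permutes UNIV" "q ` {c. ?num c < ?j} = U"
    using permutes_image_eq cardlow by metis
  let ?Q = "\<lambda>p. (\<chi> i j. if i = p j then 1 else 0) :: real^'m^'m"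
  have "lower_left_block_zero ?j (transpose (?Q p) ** A ** ?Q q)"
    unfolding lower_left_block_zero_def permutation_matrix_conj_nth
    using p(2) q(2) V'(1) zero by blast
  moreover have "permutation_matrix (?Q p)" "permutation_matrix (?Q q)"
    unfolding permutation_matrix_def using p(1) q(1) by blast+
  ultimately show ?thesis unfolding partly_decomposable_def using j by blast
qed

text \<open>Orthogonal nonnegative columns have disjoint supports, so each row vanishes on
  \<open>U\<close> or on its complement. This gives two complementary zero blocks whose row and
  column counts add up to twice \<open>CARD('m)\<close>, so one of them is large enough.\<close>

lemma partly_decomposable_if_orthogonal_columns:
  fixes A :: "real^'m^'m"
  assumes A: "zero_one_matrix A" and "U \<noteq> {}" "U \<noteq> UNIV"
    and orth: "\<And>l j. l \<in> U \<Longrightarrow> j \<notin> U \<Longrightarrow> column l A \<bullet> column j A = 0"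
  shows "partly_decomposable A"
proof -
  have nn: "0 \<le> A $ i $ j" for i j using A unfolding zero_one_matrix_def
    by (metis empty_iff insert_iff order_refl zero_le_one)
  let ?V = "{r. \<forall>c\<in>U. A $ r $ c = 0}"
  have V: "A $ r $ j = 0" if "r \<in> - ?V" "j \<in> - U" for r j
  proof -
    obtain l where l: "l \<in> U" "A $ r $ l \<noteq> 0" using \<open>r \<in> - ?V\<close> by auto
    have "(\<Sum>i\<in>UNIV. A $ i $ l * A $ i $ j) = 0"
      using orth[OF l(1), of j] that(2) by (simp add: inner_vec_def column_def)
    then have "A $ r $ l * A $ r $ j = 0"
      using nn by (subst (asm) sum_nonneg_eq_0_iff) auto
    then show ?thesis using l by simp
  qed
  show ?thesis
  proof (cases "CARD('m) \<le> card ?V + card U")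
    case True
    then show ?thesis using assms(2,3)
      by (intro partly_decomposableI[where U = U and V = ?V]) blast+
  next
    case False
    then have "CARD('m) \<le> card (- ?V) + card (- U)"
      by (simp add: Compl_eq_Diff_UNIV card_Diff_subset)
    then show ?thesis using assms(2,3) V
      by (intro partly_decomposableI[where U = "- U" and V = "- ?V"]) blast+
  qed
qed

section \<open>Block matrix calculus and the inverse of a block triangular matrix\<close>

lemma sum_UNIV_sum_type:
  fixes f :: "'k::finite + 'm::finite \<Rightarrow> 'a::comm_monoid_add"
  shows "(\<Sum>x\<in>UNIV. f x) = (\<Sum>i\<in>UNIV. f (Inl i)) + (\<Sum>j\<in>UNIV. f (Inr j))"
  unfolding UNIV_Plus_UNIV[symmetric] by (subst sum.Plus) auto

lemma block_matrix_nth [simp]: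
  "block_matrix N R L A $ Inl i $ Inl j = N $ i $ j"
  "block_matrix N R L A $ Inl i $ Inr j' = R $ i $ j'"
  "block_matrix N R L A $ Inr i' $ Inl j = L $ i' $ j"
  "block_matrix N R L A $ Inr i' $ Inr j' = A $ i' $ j'"
  by (simp_all add: block_matrix_def)

lemma block_matrix_cases:
  fixes C :: "real^('k::finite + 'm::finite)^('k + 'm)"
  obtains X Y Z W where "C = block_matrix X Y Z W"
proof
  show "C = block_matrix (\<chi> i j. C $ Inl i $ Inl j) (\<chi> i j. C $ Inl i $ Inr j)
    (\<chi> i j. C $ Inr i $ Inl j) (\<chi> i j. C $ Inr i $ Inr j)"
    by (simp add: vec_eq_iff split_sum_all)
qed

lemma block_matrix_eq_iff:
  "block_matrix X Y Z W = block_matrix X' Y' Z' W' \<longleftrightarrow> X = X' \<and> Y = Y' \<and> Z = Z' \<and> W = W'"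
  by (simp add: vec_eq_iff split_sum_all) blast

lemma mat_1_block_matrix: "mat 1 = block_matrix (mat 1) 0 0 (mat 1)"
  by (simp add: vec_eq_iff split_sum_all mat_def)

lemma block_matrix_mult:
  "block_matrix X Y Z W ** block_matrix X' Y' Z' W' =
    block_matrix (X ** X' + Y ** Z') (X ** Y' + Y ** W') (Z ** X' + W ** Z') (Z ** Y' + W ** W')"
  by (simp add: vec_eq_iff split_sum_all matrix_matrix_mult_def sum_UNIV_sum_type)

lemma block_matrix_row_inner:
  "block_matrix X Y Z W $ Inl i \<bullet> block_matrix X Y Z W $ Inl j = X $ i \<bullet> X $ j + Y $ i \<bullet> Y $ j"
  "block_matrix X Y Z W $ Inl i \<bullet> block_matrix X Y Z W $ Inr j' = X $ i \<bullet> Z $ j' + Y $ i \<bullet> W $ j'"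
  "block_matrix X Y Z W $ Inr i' \<bullet> block_matrix X Y Z W $ Inl j = Z $ i' \<bullet> X $ j + W $ i' \<bullet> Y $ j"
  "block_matrix X Y Z W $ Inr i' \<bullet> block_matrix X Y Z W $ Inr j' = Z $ i' \<bullet> Z $ j' + W $ i' \<bullet> W $ j'"
  by (simp_all add: inner_vec_def sum_UNIV_sum_type)

lemma block_upper_triangular_left_inverse:
  fixes N :: "real^'k::finite^'k" and A :: "real^'m::finite^'m"
  assumes "C ** block_matrix N R 0 A = mat 1"
  obtains X Y Z where "C = block_matrix X Y 0 Z" "X ** N = mat 1" "Z ** A = mat 1" "X ** R + Y ** A = 0"
proof -
  obtain X Y W Z where C: "C = block_matrix X Y W Z" using block_matrix_cases by blast
  have eq: "X ** N = mat 1" "X ** R + Y ** A = 0" "W ** N = 0" "W ** R + Z ** A = mat 1"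
    using assms unfolding C mat_1_block_matrix block_matrix_mult block_matrix_eq_iff by simp_all
  have "N ** X = mat 1" using eq(1) matrix_left_right_inverse by blast
  \<comment> \<open>Cancelling the invertible \<open>N\<close> in \<open>W ** N = 0\<close> removes
    the lower left block.\<close>
  then have "W = (W ** N) ** X" by (simp add: matrix_mul_assoc[symmetric])
  then have "W = 0" using eq(3) by simp
  then show ?thesis using that C eq by simp
qed

section \<open>Nonnegative combinations of 0/1 columns and orthogonality of dual bases\<close>

lemma inner_nonneg_combination:
  fixes y :: "'i::finite \<Rightarrow> 'a::real_inner"
  assumes "\<And>i j. 0 \<le> y i \<bullet> y j" "\<And>i. 0 \<le> f i" "\<And>i. 0 \<le> g i"
  shows "0 \<le> (\<Sum>i\<in>UNIV. f i *\<^sub>R y i) \<bullet> (\<Sum>j\<in>UNIV. g j *\<^sub>R y j)"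
  unfolding inner_sum_left inner_sum_right by (intro sum_nonneg) (simp add: assms)

lemma zero_one_matrix_cases:
  assumes "zero_one_matrix A"
  shows "A $ i $ j = 0 \<or> A $ i $ j = 1"
  using assms unfolding zero_one_matrix_def by blast

lemma zero_one_column_inner_nonneg:
  assumes "zero_one_matrix A"
  shows "0 \<le> column i A \<bullet> column j A"
proof -
  have "0 \<le> A $ i $ j" for i j using zero_one_matrix_cases[OF assms, of i j] by auto
  then show ?thesis by (auto simp: inner_vec_def column_def intro!: sum_nonneg)
qed

text \<open>The columns of \<open>N ** M\<close> are cube vertices lying in the simplex spanned by the origin and the
  columns of \<open>N\<close>, so they are vertices of that simplex.\<close>

lemma substochastic_coefficients_zero_one:
  fixes N X :: "real^'k^'k" and M :: "real^'m^'k"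
  assumes XN: "X ** N = mat 1" and N: "zero_one_matrix N" and NM: "zero_one_matrix (N ** M)"
    and M0: "\<And>i j. 0 \<le> M $ i $ j" and M1: "\<And>j. (\<Sum>i\<in>UNIV. M $ i $ j) \<le> 1"
  shows "M $ l $ j = 0 \<or> M $ l $ j = 1"
proof (rule disjCI)
  assume "M $ l $ j \<noteq> 1"
  show "M $ l $ j = 0"
  proof (rule ccontr)
    assume nz: "M $ l $ j \<noteq> 0"
    have R: "(N ** M) $ i $ j = (\<Sum>l\<in>UNIV. N $ i $ l * M $ l $ j)" for i
      by (simp add: matrix_matrix_mult_def)
    have N01: "0 \<le> N $ i $ c" "N $ i $ c \<le> 1" for i c
      using zero_one_matrix_cases[OF N, of i c] by auto
    \<comment> \<open>Every column of \<open>N\<close> with nonzero weight equals column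
      \<open>j\<close> of the product: an entry 0 of a nonnegative combination forces 0 in each such
      column, and an entry 1 forces 1 since the weights sum to at most 1.\<close>
    have col: "N $ i $ c = (N ** M) $ i $ j" if "M $ c $ j \<noteq> 0" for i c
    proof (cases "(N ** M) $ i $ j = 0")
      case True
      then have "(\<Sum>l\<in>UNIV. N $ i $ l * M $ l $ j) = 0" using R by simp
      then have "N $ i $ c * M $ c $ j = 0"
        using N01 M0 by (subst (asm) sum_nonneg_eq_0_iff) auto
      then show ?thesis using that True by simp
    next
      case False
      then have 1: "(N ** M) $ i $ j = 1" using zero_one_matrix_cases[OF NM] by blast
      have nn: "0 \<le> (1 - N $ i $ l) * M $ l $ j" for l using N01 M0 by simp
      have "(\<Sum>l\<in>UNIV. (1 - N $ i $ l) * M $ l $ j) = (\<Sum>l\<in>UNIV. M $ l $ j) - 1"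
        using 1 R by (simp add: left_diff_distrib sum_subtractf)
      then have "(\<Sum>l\<in>UNIV. (1 - N $ i $ l) * M $ l $ j) = 0"
        using M1[of j] nn by (metis (no_types, lifting) antisym diff_le_0_iff_le sum_nonneg)
      then have "(1 - N $ i $ c) * M $ c $ j = 0"
        using nn by (subst (asm) sum_nonneg_eq_0_iff) auto
      then show ?thesis using that 1 by simp
    qed
    \<comment> \<open>Two columns with nonzero weight would be equal, contrary to invertibility of
      \<open>N\<close>.\<close>
    have uniq: "c = l" if "M $ c $ j \<noteq> 0" for c
    proof -
      have "column c N = column l N"
        using col[OF that] col[OF nz] by (simp add: column_def)
      then show ?thesis
        using left_inverse_row_inner_column[OF XN, of c c] left_inverse_row_inner_column[OF XN, of c l]
        by (metis zero_neq_one)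
    qed
    \<comment> \<open>In a row where column \<open>l\<close> has entry 1, the product has entry
      \<open>M $ l $ j\<close>, and by \<open>col\<close> that entry is 1.\<close>
    have "column l N \<noteq> 0" using left_inverse_row_inner_column[OF XN, of l l] by auto
    then obtain i where i: "N $ i $ l \<noteq> 0" by (auto simp: vec_eq_iff column_def)
    then have N1: "N $ i $ l = 1" using zero_one_matrix_cases[OF N, of i l] by auto
    have "(\<Sum>l\<in>UNIV. N $ i $ l * M $ l $ j) = (\<Sum>c\<in>{l}. N $ i $ c * M $ c $ j)"
      by (intro sum.mono_neutral_right) (use uniq in auto)
    then have "M $ l $ j = 1" using R[of i] col[OF nz, of i] N1 by simp
    then show False using \<open>M $ l $ j \<noteq> 1\<close> by simp
  qed
qed

text \<open>The Gram matrices of dual bases are inverse to each other, so block diagonality passes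
  from one to the other. Concretely, the part \<open>y\<close> of \<open>column l B\<close> outside
  \<open>U\<close> is orthogonal both to the part \<open>x\<close> and to \<open>column l B\<close>,
  so it vanishes, and its coefficients are the inner products in question.\<close>

lemma dual_basis_orthogonal:
  fixes X B :: "real^'n^'n"
  assumes XB: "X ** B = mat 1"
    and orth: "\<And>l j. l \<in> U \<Longrightarrow> j \<notin> U \<Longrightarrow> X $ l \<bullet> X $ j = 0"
    and l: "l \<in> U" and j: "j \<notin> U"
  shows "column l B \<bullet> column j B = 0"
proof -
  note dual = left_inverse_row_inner_column[OF XB]
  define x where "x = (\<Sum>j\<in>U. (column l B \<bullet> column j B) *\<^sub>R X $ j)"
  define y where "y = (\<Sum>j\<in>-U. (column l B \<bullet> column j B) *\<^sub>R X $ j)"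
  have xy: "column l B = x + y"
  proof -
    have "column l B = (\<Sum>j\<in>U \<union> - U. (column l B \<bullet> column j B) *\<^sub>R X $ j)"
      using dual_basis_expansions(2)[OF XB, of "column l B"] by simp
    also have "\<dots> = x + y" unfolding x_def y_def by (subst sum.union_disjoint) auto
    finally show ?thesis .
  qed
  have "x \<bullet> y = 0"
    unfolding x_def y_def inner_sum_left inner_sum_right by (intro sum.neutral ballI) (simp add: orth)
  moreover have "y \<bullet> column l B = 0"
    unfolding y_def inner_sum_left using l by (intro sum.neutral ballI) (auto simp: dual)
  ultimately have "y \<bullet> y = 0" using xy by (simp add: inner_add_right inner_commute)
  then have "y \<bullet> column j B = 0" by simp
  moreover have "y \<bullet> column j B = (\<Sum>i\<in>-U. if i = j then column l B \<bullet> column j B else 0)"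
    unfolding y_def inner_sum_left by (intro sum.cong) (auto simp: dual)
  ultimately show ?thesis using j by simp
qed

lemma fully_indecomposable_zero_one_combination:
  fixes A Z :: "real^'m^'m"
  assumes ZA: "Z ** A = mat 1" and A: "zero_one_matrix A" and "fully_indecomposable A"
    and Z: "\<And>i j. i \<noteq> j \<Longrightarrow> Z $ i \<bullet> Z $ j \<le> 0"
    and nonneg: "\<And>j. 0 \<le> (\<Sum>l\<in>U. Z $ l) \<bullet> Z $ j"
  shows "U = {} \<or> U = UNIV"
proof (rule ccontr)
  assume U: "\<not> ?thesis"
  have "Z $ l \<bullet> Z $ j = 0" if "l \<in> U" "j \<notin> U" for l j
  proof -
    have le: "Z $ i \<bullet> Z $ j \<le> 0" if "i \<in> U" for i using Z that \<open>j \<notin> U\<close> by metis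
    \<comment> \<open>The terms are nonnegative by \<open>le\<close>, while \<open>nonneg\<close>
      bounds their sum above by 0.\<close>
    have "(\<Sum>i\<in>U. - (Z $ i \<bullet> Z $ j)) = 0"
      using nonneg[of j] sum_nonneg[of U "\<lambda>i. - (Z $ i \<bullet> Z $ j)"] le
      by (simp add: inner_sum_left sum_negf)
    then have "- (Z $ l \<bullet> Z $ j) = 0"
      using le that by (subst (asm) sum_nonneg_eq_0_iff) auto
    then show ?thesis by simp
  qed
  then have "column l A \<bullet> column j A = 0" if "l \<in> U" "j \<notin> U" for l j
    using dual_basis_orthogonal[OF ZA] that by metis
  then have "partly_decomposable A"
    using partly_decomposable_if_orthogonal_columns[OF A] U by blast
  then show False using assms(3) by (simp add: fully_indecomposable_def)
qed

section \<open>The block triangular nonobtuse simplex\<close>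

theorem theorem4p1:
  fixes P :: "real^('k::finite + 'm::finite)^('k + 'm)"
    and N :: "real^'k^'k" and R :: "real^'m^'k" and A :: "real^'m^'m"
  assumes "P = block_matrix N R 0 A"
    and "zero_one_matrix P" and "zero_one_matrix N" and "zero_one_matrix R" and "zero_one_matrix A"
    and "invertible P"
    and "fully_indecomposable A"
    and "nonobtuse_simplex (column_simplex P)"
  shows "nonobtuse_simplex (column_simplex N)
    \<and> nonobtuse_simplex (column_simplex A)
    \<and> (\<exists>\<nu> :: real^'k. (\<forall>i. \<nu> $ i \<in> {0, 1}) \<and> (\<nu> = 0 \<or> \<nu> \<in> columns N) \<and>
         R = (columnvector \<nu> :: real^1^'k) ** (rowvector (\<chi> j. 1) :: real^'m^1))"
proof -
  obtain C where CP: "C ** P = mat 1" using \<open>invertible P\<close> invertible_def by blast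
  obtain X Y Z where C: "C = block_matrix X Y 0 Z" and XN: "X ** N = mat 1" and ZA: "Z ** A = mat 1"
    and XRYA: "X ** R + Y ** A = 0"
    using block_upper_triangular_left_inverse CP[unfolded assms(1)] by metis
  \<comment> \<open>The sign makes \<open>b i\<close> have nonnegative inner products with the rows
    of \<open>Z\<close>; \<open>s\<close> below is the second block of the sum of all rows of
    \<open>C\<close>.\<close>
  define b where "b i = - Y $ i" for i
  define s where "s = (\<Sum>j\<in>UNIV. Z $ j) - (\<Sum>i\<in>UNIV. b i)"
  have Y: "Y $ i = - b i" for i by (simp add: b_def)
  have off: "\<And>c d. c \<noteq> d \<Longrightarrow> C $ c \<bullet> C $ d \<le> 0"
    and rows: "\<And>c. 0 \<le> C $ c \<bullet> (\<Sum>d\<in>UNIV. C $ d)"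
    using assms(8) unfolding nonobtuse_column_simplex_iff[OF CP] by blast+
  have ZZ: "Z $ i \<bullet> Z $ j \<le> 0" if "i \<noteq> j" for i j
    using off[of "Inr i" "Inr j"] that by (simp add: C block_matrix_row_inner)
  have bZ: "0 \<le> b i \<bullet> Z $ j" for i j
    using off[of "Inl i" "Inr j"] by (simp add: C block_matrix_row_inner Y)
  have XX: "X $ i \<bullet> X $ j + b i \<bullet> b j \<le> 0" if "i \<noteq> j" for i j
    using off[of "Inl i" "Inl j"] that by (simp add: C block_matrix_row_inner Y)
  have sZ: "0 \<le> s \<bullet> Z $ j" for j
    using rows[of "Inr j"]
    by (simp add: C sum_UNIV_sum_type inner_add_right inner_sum_right block_matrix_row_inner Y s_def
        inner_diff_right inner_commute[of _ "Z $ j"] sum_negf)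
  have Xs: "0 \<le> X $ i \<bullet> (\<Sum>j\<in>UNIV. X $ j) - b i \<bullet> s" for i
    using rows[of "Inl i"]
    by (simp add: C sum_UNIV_sum_type inner_add_right inner_sum_right block_matrix_row_inner Y s_def
        inner_diff_right sum_negf sum.distrib)
  note AA = zero_one_column_inner_nonneg[OF \<open>zero_one_matrix A\<close>]
  have cone: "0 \<le> x \<bullet> y" if "\<And>j. 0 \<le> x \<bullet> Z $ j" "\<And>j. 0 \<le> y \<bullet> Z $ j" for x y
    using inner_nonneg_combination[where y = "\<lambda>j. column j A" and f = "\<lambda>j. x \<bullet> Z $ j"
        and g = "\<lambda>j. y \<bullet> Z $ j", OF AA that]
    by (simp add: dual_basis_expansions(1)[OF ZA])
  note dual = left_inverse_row_inner_column[OF ZA]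
  have cone_column: "0 \<le> x \<bullet> column j A" if "\<And>j. 0 \<le> x \<bullet> Z $ j" for x j
    by (rule cone[OF that]) (simp add: inner_commute[of "column j A"] dual)

  have "nonobtuse_simplex (column_simplex N)"
    unfolding nonobtuse_column_simplex_iff[OF XN]
  proof (intro conjI allI impI)
    show "X $ i \<bullet> X $ j \<le> 0" if "i \<noteq> j" for i j
      \<comment> \<open>The inner products for \<open>N\<close> differ from those for
        \<open>P\<close> by \<open>b i \<bullet> b j\<close>, which \<open>cone\<close> shows to be
        nonnegative.\<close>
      using XX[OF that] cone[of "b i" "b j"] bZ by fastforce
    show "0 \<le> X $ i \<bullet> (\<Sum>j\<in>UNIV. X $ j)" for i
      using Xs[of i] cone[of "b i" s] bZ sZ by fastforce
  qed
  moreover have "nonobtuse_simplex (column_simplex A)"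
    unfolding nonobtuse_column_simplex_iff[OF ZA]
  proof (intro conjI allI impI)
    show "0 \<le> Z $ i \<bullet> (\<Sum>j\<in>UNIV. Z $ j)" for i
    proof -
      \<comment> \<open>The sum of the rows of \<open>Z\<close> is \<open>s\<close> plus the sum of
        the \<open>b l\<close>, and both parts have nonnegative inner product with
        \<open>Z $ i\<close>.\<close>
      have "0 \<le> (\<Sum>l\<in>UNIV. b l \<bullet> Z $ i)" by (intro sum_nonneg bZ)
      then show ?thesis using sZ[of i]
        by (simp add: s_def inner_diff_left inner_sum_left inner_commute[of "Z $ i"])
    qed
  qed (rule ZZ)
  moreover have "\<exists>\<nu> :: real^'k. (\<forall>i. \<nu> $ i \<in> {0, 1}) \<and> (\<nu> = 0 \<or> \<nu> \<in> columns N) \<and>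
         R = (columnvector \<nu> :: real^1^'k) ** (rowvector (\<chi> j. 1) :: real^'m^1)"
  proof -
    define M where "M = X ** R"
    have M: "M $ i $ j = b i \<bullet> column j A" for i j
    proof -
      have "(X ** R + Y ** A) $ i $ j = 0" using XRYA by simp
      then show ?thesis
        by (simp add: M_def b_def matrix_matrix_mult_def[of Y] inner_vec_def column_def sum_negf)
    qed
    have "N ** X = mat 1" using XN matrix_left_right_inverse by blast
    then have NM: "N ** M = R" by (simp add: M_def matrix_mul_assoc)
    have M0: "0 \<le> M $ i $ j" for i j unfolding M by (intro cone_column bZ)
    \<comment> \<open>The slack in this inequality is \<open>s \<bullet> column j A\<close>, because
      the sum of the rows of \<open>Z\<close> has inner product 1 with each column of
      \<open>A\<close>.\<close>
    have M1: "(\<Sum>i\<in>UNIV. M $ i $ j) \<le> 1" for j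
      using cone_column[of s j, OF sZ]
      by (simp add: M s_def inner_diff_left inner_sum_left dual)
    have M01: "M $ i $ j = 0 \<or> M $ i $ j = 1" for i j
      using substochastic_coefficients_zero_one[OF XN assms(3), of M] M0 M1 NM assms(4) by simp
    have const: "{j. M $ i $ j = 1} = {} \<or> {j. M $ i $ j = 1} = UNIV" for i
    proof (rule fully_indecomposable_zero_one_combination[OF ZA assms(5,7) ZZ])
      have "(\<Sum>l\<in>{j. M $ i $ j = 1}. Z $ l) = (\<Sum>l\<in>UNIV. M $ i $ l *\<^sub>R Z $ l)"
        by (rule sum.mono_neutral_cong_left) (use M01 in auto)
      also have "\<dots> = b i" unfolding M by (rule dual_basis_expansions(2)[OF ZA])
      finally show "0 \<le> (\<Sum>l\<in>{j. M $ i $ j = 1}. Z $ l) \<bullet> Z $ j" for j using bZ by simp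
    qed
    have R: "R $ i $ j = (\<Sum>l\<in>UNIV. N $ i $ l * M $ l $ j)" for i j
      by (simp add: NM[symmetric] matrix_matrix_mult_def)
    have rank1: "R = (columnvector \<nu> :: real^1^'k) ** (rowvector (\<chi> j. 1) :: real^'m^1)"
      if "\<And>i j. R $ i $ j = \<nu> $ i" for \<nu>
      using that by (simp add: vec_eq_iff matrix_matrix_mult_def columnvector_def rowvector_def)
    show ?thesis
    proof (cases "\<exists>i. {j. M $ i $ j = 1} = UNIV")
      case True
      then obtain c where c: "\<And>j. M $ c $ j = 1" by blast
      \<comment> \<open>Row \<open>c\<close> alone already exhausts the bound 1 on each column sum,
        so all other rows of \<open>M\<close> vanish and every column of \<open>R\<close> is column
        \<open>c\<close> of \<open>N\<close>.\<close>
      have other: "M $ l $ j = 0" if "l \<noteq> c" for l j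
      proof -
        have "(\<Sum>i\<in>{l, c}. M $ i $ j) \<le> (\<Sum>i\<in>UNIV. M $ i $ j)"
          by (intro sum_mono2) (auto simp: M0)
        then show ?thesis using M1[of j] M0[of l j] c[of j] that by simp
      qed
      have "R $ i $ j = column c N $ i" for i j
      proof -
        have "R $ i $ j = (\<Sum>l\<in>{c}. N $ i $ l * M $ l $ j)"
          unfolding R by (intro sum.mono_neutral_right) (auto simp: other)
        then show ?thesis by (simp add: c column_def)
      qed
      then show ?thesis using rank1[of "column c N"] zero_one_matrix_cases[OF assms(3)]
        by (intro exI[of _ "column c N"]) (auto simp: columns_def column_def)
    next
      case False
      then have "M $ i $ j = 0" for i j using const[of i] M01[of i j] by blast
      then have "R $ i $ j = (0 :: real^'k) $ i" for i j by (simp add: R)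
      then show ?thesis using rank1[of 0] by (intro exI[of _ 0]) auto
    qed
  qed
  ultimately show ?thesis by blast
qed

end
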